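(* Assume the continuum hypothesis ($2^{\aleph_0}=\aleph_1$). Let $X$ be a Tychonoff space in which every point is a $G_\delta$. If player II has a winning strategy in the game $\mathsf{G}_{\mathrm{fin}}^{\omega_1}(\mathrm{O},\mathrm{O})$ on $X$, then $|X|\le 2^{\aleph_0}$.
   Context: A space has points $G_\delta$ if for every $x\in X$ the singleton $\{x\}$ is the intersection of countably many open sets. $\mathrm{O}$ denotes the family of all open coverings of $X$. The game $\mathsf{G}_{\mathrm{fin}}^{\kappa}(\mathrm{O},\mathrm{O})$ (long Menger game) is played by players I and II as follows: in each inning $\xi<\kappa$, player I chooses an open covering $\mathcal{A}_\xi$ of $X$, and then player II chooses a finite subset $\mathcal{F}_\xi\subset\mathcal{A}_\xi$. Player II wins if $\bigcup_{\xi<\kappa}\mathcal{F}_\xi$ is a covering of $X$; otherwise player I wins. A strategy for player II is a function assigning to each sequence of moves of player I up to and including the current inning a legal move of player II; it is winning if player II wins every play in which II follows it. *)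

theory Defs
  imports "HOL-Analysis.Analysis"
begin

unbundle cardinal_syntax

(* The cardinal successor of natLeq is a well-order of type omega_1 on a set of sets of
   naturals; the field of this relation serves as the index set {xi. xi < omega_1}. *)
definition omega1 :: "nat set rel" where
  "omega1 = cardSuc natLeq"

definition continuum_hypothesis :: bool where
  "continuum_hypothesis \<longleftrightarrow> ctwo ^c natLeq =o omega1"

(* The separation axiom T1 is not part of the library's complete regularity. *)
definition tychonoff_space :: "'a topology \<Rightarrow> bool" where
  "tychonoff_space X \<longleftrightarrow> completely_regular_space X \<and> t1_space X"

definition points_gdelta :: "'a topology \<Rightarrow> bool" where
  "points_gdelta X \<longleftrightarrow> (\<forall>x \<in> topspace X. gdelta_in X {x})"

definition open_coverings :: "'a topology \<Rightarrow> 'a set set set" where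
  "open_coverings X = {\<U>. (\<forall>U \<in> \<U>. openin X U) \<and> \<Union>\<U> = topspace X}"

(* The innings of the long Menger game are the elements of the field of a well-order r
   (whose order type is the length of the game).  A strategy s of player II takes an inning xi
   and the sequence of moves of player I in the innings eta <= xi, a function on under r xi
   (extended by undefined outside), to the answer of player II in inning xi. *)
definition menger_strategy_II ::
  "'i rel \<Rightarrow> 'a topology \<Rightarrow> ('i \<Rightarrow> ('i \<Rightarrow> 'a set set) \<Rightarrow> 'a set set) \<Rightarrow> bool" where
  "menger_strategy_II r X s \<longleftrightarrow>
     (\<forall>\<xi> \<in> Field r. \<forall>p \<in> under r \<xi> \<rightarrow>\<^sub>E open_coverings X. finite (s \<xi> p) \<and> s \<xi> p \<subseteq> p \<xi>)"

definition menger_winning_strategy_II ::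
  "'i rel \<Rightarrow> 'a topology \<Rightarrow> ('i \<Rightarrow> ('i \<Rightarrow> 'a set set) \<Rightarrow> 'a set set) \<Rightarrow> bool" where
  "menger_winning_strategy_II r X s \<longleftrightarrow>
     menger_strategy_II r X s \<and>
     (\<forall>A \<in> Field r \<rightarrow>\<^sub>E open_coverings X.
        \<Union>(\<Union>\<xi> \<in> Field r. s \<xi> (restrict A (under r \<xi>))) = topspace X)"

end

(* For a position p of the game (the moves of player I before some inning), let K(p) be the
   intersection, over all open coverings A, of the closures of the union of the answer to p
   followed by A.  By regularity K(p) is compact, so it has at most continuum many points by
   Arhangel'skii's theorem.  Finite unions of the open sets witnessing that the points of K(p)
   are G-delta express the complement of K(p) as a union of continuum many closed sets.  Since
   player II wins, every open covering of X has a subcovering of size at most omega_1, so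
   continuum many coverings A suffice to have each point outside K(p) missed by some answer.
   Restricting player I to these coverings leaves a tree of height omega_1 with at most
   (2^omega)^omega = 2^omega positions.  A point outside every K(p) would be missed along a
   whole branch, so the sets K(p) of the tree cover X. *)

theory Submission
  imports Defs
begin

section \<open>Sets of size at most continuum\<close>

abbreviation at_most_continuum :: "'a set \<Rightarrow> bool" where
  "at_most_continuum A \<equiv> |A| \<le>o |UNIV :: nat set set|"

lemma infinite_nat_set: "infinite (UNIV :: nat set set)"
  using finite_Pow_iff[of "UNIV :: nat set"] by simp

lemma at_most_continuum_image:
  assumes "at_most_continuum A"
  shows "at_most_continuum (f ` A)"
  using card_of_image assms by (rule ordLeq_transitive)

lemma at_most_continuum_subset:
  assumes "at_most_continuum B" "A \<subseteq> B"
  shows "at_most_continuum A"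
  using card_of_mono1[OF assms(2)] assms(1) by (rule ordLeq_transitive)

lemma at_most_continuum_UN:
  assumes "at_most_continuum I" "\<And>i. i \<in> I \<Longrightarrow> at_most_continuum (A i)"
  shows "at_most_continuum (\<Union>i\<in>I. A i)"
  using card_of_UNION_ordLeq_infinite[OF infinite_nat_set] assms by blast

lemma at_most_continuum_inj_on:
  fixes f :: "'a \<Rightarrow> 'b"
  assumes "at_most_continuum (UNIV :: 'b set)" "inj_on f A"
  shows "at_most_continuum A"
proof -
  have "|A| \<le>o |UNIV :: 'b set|"
    using assms(2) card_of_ordLeq by blast
  then show ?thesis
    using assms(1) by (rule ordLeq_transitive)
qed

lemma at_most_continuum_countable:
  assumes "countable A"
  shows "at_most_continuum A"
proof -
  have "inj_on (\<lambda>x. {to_nat_on A x}) A"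
    using inj_on_to_nat_on[OF assms] by (auto simp: inj_on_def)
  then show ?thesis
    using at_most_continuum_inj_on[OF ordLeq_refl[OF card_of_Card_order]] by blast
qed

lemma at_most_continuum_countable_Pow:
  "at_most_continuum (UNIV :: 'a::countable set set)"
proof (rule at_most_continuum_inj_on)
  show "at_most_continuum (UNIV :: nat set set)"
    using card_of_Card_order by (rule ordLeq_refl)
  show "inj ((`) to_nat :: 'a set \<Rightarrow> nat set)"
    using inj_on_image by (simp add: inj_image_eq_iff inj_on_def)
qed

lemma at_most_continuum_sequences:
  "at_most_continuum (UNIV :: (nat \<Rightarrow> nat set) set)"
proof (rule at_most_continuum_inj_on)
  show "at_most_continuum (UNIV :: (nat \<times> nat) set set)"
    by (rule at_most_continuum_countable_Pow)
  show "inj (\<lambda>f::nat \<Rightarrow> nat set. {(i, j). j \<in> f i})"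
    by (rule injI) (simp add: fun_eq_iff set_eq_iff)
qed

lemma at_most_continuum_Times:
  assumes "at_most_continuum A" "at_most_continuum B"
  shows "at_most_continuum (A \<times> B)"
proof -
  have "A \<times> B = (\<Union>a\<in>A. Pair a ` B)"
    by auto
  then show ?thesis
    using at_most_continuum_UN[OF assms(1) at_most_continuum_image[OF assms(2)]] by simp
qed

text \<open>A finite subset is decoded from its size and a sequence of sets of naturals naming its
  elements, and there are only continuum many such pairs.\<close>

lemma at_most_continuum_finite_subsets:
  assumes "at_most_continuum B"
  shows "at_most_continuum {F. finite F \<and> F \<subseteq> B}"
proof -
  obtain f :: "'a \<Rightarrow> nat set" where f: "inj_on f B"
    using assms card_of_ordLeq[of B "UNIV :: nat set set"] by blast
  let ?D = "\<lambda>(k, g). (\<lambda>i::nat. inv_into B f (g i)) ` {..<k}"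
  have "{F. finite F \<and> F \<subseteq> B} \<subseteq> range ?D"
  proof clarify
    fix F assume F: "finite F" "F \<subseteq> B"
    obtain h where h: "bij_betw h {0..<card F} F"
      using ex_bij_betw_nat_finite[OF F(1)] by blast
    have "h i \<in> B" if "i < card F" for i
      using that F(2) bij_betwE[OF h] by auto
    then have "inv_into B f (f (h i)) = h i" if "i < card F" for i
      using that inv_into_f_f[OF f] by blast
    then have "?D (card F, \<lambda>i. f (h i)) = h ` {0..<card F}"
      by (auto intro!: image_eqI)
    also have "\<dots> = F"
      using h by (simp add: bij_betw_def)
    finally show "F \<in> range ?D"
      by (metis rangeI)
  qed
  moreover have "at_most_continuum (UNIV :: (nat \<times> (nat \<Rightarrow> nat set)) set)"
    using at_most_continuum_Times[OF at_most_continuum_countable at_most_continuum_sequences,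
        of "UNIV :: nat set"] by simp
  ultimately show ?thesis
    by (rule at_most_continuum_subset[OF at_most_continuum_image, rotated])
qed

section \<open>Terms over countably many operations of arity omega\<close>

datatype omega_tree = Leaf | Node nat "nat \<Rightarrow> omega_tree"

text \<open>Labels and child indices alternate along a path, and each path ends in a label. This
  codes an infinitely branching tree as a subset of the countable type
  \<open>nat list\<close>.\<close>

primrec tree_paths :: "omega_tree \<Rightarrow> nat list set" where
  "tree_paths Leaf = {}"
| "tree_paths (Node k f) = {[k]} \<union> {k # i # w | i w. w \<in> tree_paths (f i)}"

text \<open>A leaf has no path, the only path of length one is the root label, and stripping two
  entries from the longer paths recovers each child.\<close>

lemma inj_tree_paths: "inj tree_paths"
proof (rule injI)
  fix s t assume "tree_paths s = tree_paths t"
  then show "s = t"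
  proof (induction s arbitrary: t)
    case Leaf
    then show ?case by (cases t) auto
  next
    case (Node k f)
    then obtain l g where t: "t = Node l g"
      by (cases t) auto
    have "[k] \<in> tree_paths t"
      using Node.prems by auto
    then have kl: "k = l"
      by (simp add: t)
    have "tree_paths (f i) = tree_paths (g i)" for i
    proof -
      have "w \<in> tree_paths (f i) \<longleftrightarrow> k # i # w \<in> tree_paths (Node k f)" for w
        by simp
      moreover have "w \<in> tree_paths (g i) \<longleftrightarrow> k # i # w \<in> tree_paths t" for w
        by (simp add: t kl)
      ultimately show ?thesis
        using Node.prems by blast
    qed
    then have "f i = g i" for i
      using Node.IH by blast
    then show ?case
      by (simp add: t kl fun_eq_iff)
  qed
qed

primrec tree_value :: "'a \<Rightarrow> (nat \<Rightarrow> (nat \<Rightarrow> 'a) \<Rightarrow> 'a) \<Rightarrow> omega_tree \<Rightarrow> 'a" where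
  "tree_value a opn Leaf = a"
| "tree_value a opn (Node k f) = opn k (\<lambda>i. tree_value a opn (f i))"

text \<open>Trees are terms in the operations \<open>opn k\<close>. A sequence of values lifts to a
  sequence of terms, and these are the children of a new term, so the set of all values is closed at
  once, without a transfinite construction of length omega_1.\<close>

lemma closure_under_sequence_operations:
  fixes opn :: "nat \<Rightarrow> (nat \<Rightarrow> 'a) \<Rightarrow> 'a"
  assumes "a \<in> A" "\<And>k z. opn k z \<in> A"
  obtains H where "H \<subseteq> A" "a \<in> H" "at_most_continuum H"
    "\<And>k z. range z \<subseteq> H \<Longrightarrow> opn k z \<in> H"
proof
  let ?val = "tree_value a opn"
  show "range ?val \<subseteq> A"
  proof clarify
    fix t show "?val t \<in> A"
      using assms by (cases t) auto
  qed
  show "a \<in> range ?val"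
    by (rule range_eqI[of _ _ Leaf]) simp
  show "at_most_continuum (range ?val)"
    by (intro at_most_continuum_image
        at_most_continuum_inj_on[OF at_most_continuum_countable_Pow inj_tree_paths])
  show "opn k z \<in> range ?val" if "range z \<subseteq> range ?val" for k z
  proof -
    have "\<forall>i. \<exists>t. z i = ?val t"
      using that by blast
    then obtain f where "\<And>i. z i = ?val (f i)"
      by metis
    then have "z = (\<lambda>i. ?val (f i))"
      by blast
    then have "opn k z = ?val (Node k f)"
      by simp
    then show ?thesis
      by blast
  qed
qed

text \<open>Relative to the earlier moves, each move is coded by one set of naturals, so countably
  many moves amount to one sequence of such sets. The code determines the branch by induction along
  \<open>r\<close>: branches that agree below \<open>b\<close> use the same injection at
  \<open>b\<close>.\<close>

lemma at_most_continuum_branches: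
  fixes r :: "'i rel" and M :: "'i \<Rightarrow> ('i \<Rightarrow> 'b) \<Rightarrow> 'b set"
  assumes "Well_order r" "countable (underS r a)"
    and branching: "\<And>b q. at_most_continuum (M b q)"
  shows "at_most_continuum
    {p \<in> extensional (underS r a). \<forall>b\<in>underS r a. p b \<in> M b (restrict p (underS r b))}"
    (is "at_most_continuum ?P")
proof -
  have wo: "wo_rel r"
    using assms(1) by (simp add: wo_rel_def)
  have "\<exists>e :: 'b \<Rightarrow> nat set. inj_on e (M b q)" for b q
    using branching[of b q] card_of_ordLeq[of "M b q" "UNIV :: nat set set"] by blast
  then obtain e :: "'i \<Rightarrow> ('i \<Rightarrow> 'b) \<Rightarrow> 'b \<Rightarrow> nat set" where e: "\<And>b q. inj_on (e b q) (M b q)"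
    by metis
  let ?b = "from_nat_into (underS r a)"
  define code where
    "code p n = e (?b n) (restrict p (underS r (?b n))) (p (?b n))" for p n
  have "inj_on code ?P"
  proof (rule inj_onI)
    fix p p' assume p: "p \<in> ?P" and p': "p' \<in> ?P" and eq: "code p = code p'"
    have "b \<in> underS r a \<longrightarrow> p b = p' b" for b
    proof (induction b rule: wf_induct_rule[OF wo_rel.WF[OF wo]])
      case (1 b)
      show ?case
      proof
        assume b: "b \<in> underS r a"
        have "underS r b \<subseteq> underS r a"
          using underS_incr[OF wo_rel.TRANS[OF wo] wo_rel.ANTISYM[OF wo]] b by (auto simp: underS_def)
        then have restr: "restrict p (underS r b) = restrict p' (underS r b)"
          using "1.IH" by (auto simp: restrict_def fun_eq_iff underS_def)
        obtain n where n: "?b n = b"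
          using from_nat_into_to_nat_on[OF assms(2) b] by blast
        have "e b (restrict p (underS r b)) (p b) = e b (restrict p (underS r b)) (p' b)"
          using fun_cong[OF eq, of n] by (simp add: code_def n restr)
        moreover have "p b \<in> M b (restrict p (underS r b))" "p' b \<in> M b (restrict p (underS r b))"
          using p p' b restr by auto
        ultimately show "p b = p' b"
          using e inj_onD by metis
      qed
    qed
    then show "p = p'"
      using p p' by (auto intro: extensionalityI)
  qed
  then show ?thesis
    by (rule at_most_continuum_inj_on[OF at_most_continuum_sequences])
qed

section \<open>Compact Hausdorff spaces with G-delta points\<close>

text \<open>Regularity puts closed neighbourhoods \<open>D n\<close> of \<open>x\<close> inside the
  given open sets. They meet only in \<open>x\<close>, so by compactness of the complement of
  \<open>U\<close> finitely many of them already have their intersection inside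
  \<open>U\<close>.\<close>

lemma compact_gdelta_point_neighbourhood_base:
  assumes "compact_space X" "Hausdorff_space X" "gdelta_in X {x}"
  obtains W :: "nat \<Rightarrow> 'a set" where
    "\<And>n. openin X (W n)" "\<And>n. x \<in> W n" "\<And>m n. m \<le> n \<Longrightarrow> W n \<subseteq> W m"
    "\<And>U. openin X U \<Longrightarrow> x \<in> U \<Longrightarrow> \<exists>n. W n \<subseteq> U"
proof -
  obtain C :: "nat \<Rightarrow> 'a set" where C: "\<And>n. openin X (C n)" "\<Inter> (range C) = {x}"
    using assms(3) unfolding gdelta_in_descending by blast
  have x: "x \<in> C n" for n
    using C(2) by blast
  have "\<exists>V D. openin X V \<and> closedin X D \<and> x \<in> V \<and> V \<subseteq> D \<and> D \<subseteq> C n" for n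
    using compact_Hausdorff_imp_regular_space[OF assms(1,2)] C(1) x
    unfolding neighbourhood_base_of_closedin[symmetric] neighbourhood_base_of by blast
  then obtain V D :: "nat \<Rightarrow> 'a set" where V: "\<And>n. openin X (V n)" "\<And>n. closedin X (D n)" "\<And>n. x \<in> V n"
    "\<And>n. V n \<subseteq> D n" "\<And>n. D n \<subseteq> C n"
    by metis
  show thesis
  proof
    show "openin X (\<Inter>i\<le>n. V i)" for n :: nat
      using V(1) by (intro openin_Inter) auto
    show "x \<in> (\<Inter>i\<le>n. V i)" for n :: nat
      using V(3) by blast
    show "(\<Inter>i\<le>n. V i) \<subseteq> (\<Inter>i\<le>m. V i)" if "m \<le> n" for m n :: nat
      using that by (intro INF_superset_mono) auto
    show "\<exists>n. (\<Inter>i\<le>n. V i) \<subseteq> U" if U: "openin X U" "x \<in> U" for U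
    proof -
      have "compactin X (topspace X - U)"
        using assms(1) U(1) by (intro closedin_compact_space closedin_diff) auto
      moreover have "topspace X - U \<subseteq> \<Union> (range (\<lambda>n. topspace X - D n))"
        using C(2) V(5) U(2) by fastforce
      moreover have "\<forall>T \<in> range (\<lambda>n. topspace X - D n). openin X T"
        using V(2) by blast
      ultimately obtain F where F: "finite F" "F \<subseteq> range (\<lambda>n. topspace X - D n)"
          "topspace X - U \<subseteq> \<Union> F"
        unfolding compactin_def by meson
      then obtain N where N: "finite N" "F = (\<lambda>n. topspace X - D n) ` N"
        using finite_subset_image[OF F(1,2)] by blast
      \<comment> \<open>Inserting 0 keeps \<open>Max\<close> meaningful when \<open>N\<close> is
        empty, which can happen if \<open>U\<close> is the whole space.\<close>
      have "(\<Inter>i\<le>Max (insert 0 N). V i) \<subseteq> U"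
      proof
        fix y assume y: "y \<in> (\<Inter>i\<le>Max (insert 0 N). V i)"
        have "y \<in> D i" if "i \<in> N" for i
        proof -
          have "i \<le> Max (insert 0 N)"
            using N(1) that by (intro Max_ge) auto
          then show ?thesis
            using y V(4) by blast
        qed
        then have "y \<notin> \<Union> F"
          using N(2) by auto
        moreover have "y \<in> topspace X"
          using y V(1)[of 0] openin_subset by blast
        ultimately show "y \<in> U"
          using F(3) by blast
      qed
      then show ?thesis ..
    qed
  qed
qed

text \<open>Arhangel'skii's closing-off argument: a set that is closed under limits of sequences is
  compact, and if it also contains a point outside each non-covering finite union of basic
  neighbourhoods of its elements, then it is the whole space. Both operations have countable
  arity, so such a set can be generated by continuum many terms.\<close>

theorem compact_Hausdorff_points_gdelta_at_most_continuum:
  assumes "compact_space X" "Hausdorff_space X" "\<And>x. x \<in> topspace X \<Longrightarrow> gdelta_in X {x}"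
  shows "at_most_continuum (topspace X)"
proof (cases "topspace X = {}")
  case True
  then show ?thesis
    by (simp add: at_most_continuum_countable)
next
  case False
  then obtain a where a: "a \<in> topspace X"
    by blast
  have "\<forall>x. \<exists>W :: nat \<Rightarrow> 'a set. x \<in> topspace X \<longrightarrow> (\<forall>n. openin X (W n)) \<and> (\<forall>n. x \<in> W n) \<and>
      (\<forall>m n. m \<le> n \<longrightarrow> W n \<subseteq> W m) \<and> (\<forall>U. openin X U \<longrightarrow> x \<in> U \<longrightarrow> (\<exists>n. W n \<subseteq> U))"
    using compact_gdelta_point_neighbourhood_base[OF assms(1,2) assms(3)] by metis
  then obtain W :: "'a \<Rightarrow> nat \<Rightarrow> 'a set" where W:
    "\<And>x n. x \<in> topspace X \<Longrightarrow> openin X (W x n)" "\<And>x n. x \<in> topspace X \<Longrightarrow> x \<in> W x n"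
    "\<And>x m n. x \<in> topspace X \<Longrightarrow> m \<le> n \<Longrightarrow> W x n \<subseteq> W x m"
    "\<And>x U. x \<in> topspace X \<Longrightarrow> openin X U \<Longrightarrow> x \<in> U \<Longrightarrow> \<exists>n. W x n \<subseteq> U"
    by metis
  \<comment> \<open>The default \<open>a\<close> keeps the operations total, with all values in the
    space.\<close>
  define pick where "pick P = (if \<exists>x\<in>topspace X. P x then SOME x. x \<in> topspace X \<and> P x else a)"
    for P
  have pick: "pick P \<in> topspace X \<and> P (pick P)" if "x \<in> topspace X" "P x" for P x
    using that someI_ex[of "\<lambda>x. x \<in> topspace X \<and> P x"] by (auto simp: pick_def)
  have pick_in: "pick P \<in> topspace X" for P
  proof (cases "\<exists>x\<in>topspace X. P x")
    case True
    then show ?thesis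
      using pick by blast
  next
    case False
    then show ?thesis
      using a by (simp add: pick_def)
  qed
  \<comment> \<open>Operation 0 is meant to return the limit of \<open>z\<close>. Operation
    \<open>Suc l\<close> reads \<open>l\<close> as a list of neighbourhood indices for the first
    entries of \<open>z\<close> and leaves the union of these neighbourhoods whenever
    possible.\<close>
  define opn where "opn k z = (case k of
      0 \<Rightarrow> pick (\<lambda>x. \<forall>n. z n \<in> W x n)
    | Suc l \<Rightarrow> let ns = from_nat l :: nat list in
        pick (\<lambda>x. x \<notin> (\<Union>i<length ns. W (z i) (ns ! i))))" for k z
  have "opn k z \<in> topspace X" for k z
    by (cases k) (simp_all add: opn_def pick_in Let_def)
  then obtain H where H: "H \<subseteq> topspace X" "a \<in> H" "at_most_continuum H"
      and closed: "\<And>k z. range z \<subseteq> H \<Longrightarrow> opn k z \<in> H"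
    using closure_under_sequence_operations[OF a, of opn] by metis
  \<comment> \<open>Since the \<open>W x n\<close> form a decreasing base, the assumption on
    \<open>z\<close> makes it converge to \<open>x\<close>. Uniqueness of limits forces operation 0
    to return this very point.\<close>
  have limit_unique: "x = y"
    if x: "x \<in> topspace X" and y: "y \<in> topspace X"
      and z: "\<forall>n. z n \<in> W x n" "\<forall>n. z n \<in> W y n" for x y z
  proof (rule ccontr)
    assume "x \<noteq> y"
    then obtain U V where U: "openin X U" "openin X V" "x \<in> U" "y \<in> V" "disjnt U V"
      using assms(2) x y unfolding Hausdorff_space_def by blast
    obtain m n where "W x m \<subseteq> U" "W y n \<subseteq> V"
      using W(4)[OF x U(1,3)] W(4)[OF y U(2,4)] by blast
    then have "W x (max m n) \<subseteq> U" "W y (max m n) \<subseteq> V"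
      using W(3)[OF x, of m "max m n"] W(3)[OF y, of n "max m n"] by auto
    then show False
      using z U(5) by (meson disjnt_iff subsetD)
  qed
  have "X closure_of H \<subseteq> H"
  proof
    fix x assume x: "x \<in> X closure_of H"
    then have xX: "x \<in> topspace X"
      by (simp add: in_closure_of)
    then have "\<forall>n. \<exists>y. y \<in> H \<and> y \<in> W x n"
      using x W(1,2) by (meson in_closure_of)
    then obtain z where z: "\<And>n. z n \<in> H" "\<And>n. z n \<in> W x n"
      by metis
    have "opn 0 z = pick (\<lambda>x. \<forall>n. z n \<in> W x n)"
      by (simp add: opn_def)
    also have "\<dots> = x"
      using pick[OF xX, of "\<lambda>x. \<forall>n. z n \<in> W x n"] z(2) xX by (intro limit_unique[of _ _ z]) auto
    finally show "x \<in> H"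
      using closed[of z 0] z(1) by auto
  qed
  then have "closedin X H"
    using H(1) closure_of_subset_eq by blast
  then have compact: "compactin X H"
    using assms(1) closedin_compact_space by blast
  have "topspace X \<subseteq> H"
  proof
    fix y assume y: "y \<in> topspace X"
    show "y \<in> H"
    proof (rule ccontr)
      assume "y \<notin> H"
      have "\<exists>n. y \<notin> W x n" if x: "x \<in> H" for x
      proof -
        have "openin X (topspace X - {y})"
          using Hausdorff_imp_t1_space[OF assms(2)] y by (simp add: t1_space_closedin_singleton openin_diff)
        then obtain n where "W x n \<subseteq> topspace X - {y}"
          using W(4)[of x "topspace X - {y}"] x H(1) \<open>y \<notin> H\<close> by blast
        then show ?thesis
          by blast
      qed
      then obtain n where n: "\<And>x. x \<in> H \<Longrightarrow> y \<notin> W x (n x)"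
        by metis
      have "H \<subseteq> \<Union> ((\<lambda>x. W x (n x)) ` H)"
        using W(2) H(1) by blast
      moreover have "\<forall>T \<in> (\<lambda>x. W x (n x)) ` H. openin X T"
        using W(1) H(1) by blast
      ultimately obtain F where F: "finite F" "F \<subseteq> (\<lambda>x. W x (n x)) ` H" "H \<subseteq> \<Union> F"
        using compact unfolding compactin_def by meson
      obtain G where G: "finite G" "G \<subseteq> H" "F = (\<lambda>x. W x (n x)) ` G"
        using finite_subset_image[OF F(1,2)] by blast
      obtain xs where xs: "set xs = G"
        using finite_list[OF G(1)] by blast
      \<comment> \<open>Operations take infinite sequences, so the finite list is padded with
        \<open>a\<close>, which lies in \<open>H\<close>; only the first \<open>length ns\<close>
        entries matter.\<close>
      define z where "z i = (if i < length xs then xs ! i else a)" for i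
      define ns where "ns = map n xs"
      let ?U = "\<Union>i<length ns. W (z i) (ns ! i)"
      have z: "range z \<subseteq> H"
        using G(2) xs H(2) by (auto simp: z_def)
      have "?U = (\<Union>i<length xs. W (xs ! i) (n (xs ! i)))"
        by (auto simp: z_def ns_def)
      also have "\<dots> = \<Union> F"
        unfolding G(3) xs[symmetric] set_conv_nth by auto
      finally have U: "?U = \<Union> F" .
      have "y \<notin> ?U"
        unfolding U G(3) using n G(2) by blast
      then have "pick (\<lambda>x. x \<notin> ?U) \<notin> ?U"
        using pick[OF y, of "\<lambda>x. x \<notin> ?U"] by blast
      moreover have "pick (\<lambda>x. x \<notin> ?U) = opn (Suc (to_nat ns)) z"
        by (simp add: opn_def)
      moreover have "opn (Suc (to_nat ns)) z \<in> ?U"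
        unfolding U using closed[OF z] F(3) by blast
      ultimately show False
        by simp
    qed
  qed
  then show ?thesis
    by (rule at_most_continuum_subset[OF H(3)])
qed

corollary compactin_points_gdelta_at_most_continuum:
  assumes "Hausdorff_space X" "points_gdelta X" "compactin X K"
  shows "at_most_continuum K"
proof -
  have K: "topspace (subtopology X K) = K"
    using compactin_subset_topspace[OF assms(3)] by auto
  have "gdelta_in (subtopology X K) {x}" if "x \<in> K" for x
    using assms(2) that K unfolding points_gdelta_def gdelta_in_subtopology
    by (intro exI[of _ "{x}"]) auto
  then show ?thesis
    using compact_Hausdorff_points_gdelta_at_most_continuum[of "subtopology X K"] assms K
    by (metis Hausdorff_space_subtopology compactin_subspace)
qed

section \<open>One inning of the Menger game\<close>

text \<open>Each finite union \<open>W F\<close> containing \<open>K\<close> completes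
  \<open>\<G>\<close> to an open covering of the space. The members of \<open>\<G>\<close> in a
  small subcovering then cover everything outside \<open>W F\<close>, and there are only continuum
  many such \<open>F\<close>.\<close>

lemma subcover_outside_compact:
  assumes lindelof: "\<And>\<U>. \<U> \<in> open_coverings X \<Longrightarrow>
      \<exists>\<V>\<subseteq>\<U>. at_most_continuum \<V> \<and> \<Union>\<V> = topspace X"
    and "points_gdelta X" "compactin X K" "at_most_continuum K"
    and \<G>: "\<And>G. G \<in> \<G> \<Longrightarrow> openin X G" "topspace X - K \<subseteq> \<Union>\<G>"
  obtains \<H> where "\<H> \<subseteq> \<G>" "at_most_continuum \<H>" "topspace X - K \<subseteq> \<Union>\<H>"
proof -
  have KX: "K \<subseteq> topspace X"
    using assms(3) compactin_subset_topspace by blast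
  have "\<exists>C :: nat \<Rightarrow> 'a set. (\<forall>n. openin X (C n)) \<and> \<Inter> (range C) = {x}" if "x \<in> K" for x
  proof -
    have "gdelta_in X {x}"
      using assms(2) KX that by (auto simp: points_gdelta_def)
    then show ?thesis
      unfolding gdelta_in_descending by metis
  qed
  then obtain C :: "'a \<Rightarrow> nat \<Rightarrow> 'a set" where
    C: "\<And>x n. x \<in> K \<Longrightarrow> openin X (C x n)" "\<And>x. x \<in> K \<Longrightarrow> \<Inter> (range (C x)) = {x}"
    by metis
  define W where "W F = (\<Union>(x, n)\<in>F. C x n)" for F
  let ?\<F> = "{F. finite F \<and> F \<subseteq> K \<times> (UNIV :: nat set)}"
  define I where "I = {F \<in> ?\<F>. K \<subseteq> W F}"
  have "\<forall>F\<in>I. \<exists>\<V>. \<V> \<subseteq> insert (W F) \<G> \<and> at_most_continuum \<V> \<and> \<Union>\<V> = topspace X"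
  proof
    fix F assume "F \<in> I"
    then have F: "F \<in> ?\<F>" "K \<subseteq> W F"
      by (auto simp: I_def)
    have W: "openin X (W F)"
      unfolding W_def using C(1) F(1) by (intro openin_Union) auto
    have "\<Union> (insert (W F) \<G>) = topspace X"
    proof
      show "\<Union> (insert (W F) \<G>) \<subseteq> topspace X"
        using W \<G>(1) openin_subset by blast
      show "topspace X \<subseteq> \<Union> (insert (W F) \<G>)"
        using F(2) \<G>(2) by blast
    qed
    then have "insert (W F) \<G> \<in> open_coverings X"
      using W \<G>(1) by (auto simp: open_coverings_def)
    then show "\<exists>\<V>. \<V> \<subseteq> insert (W F) \<G> \<and> at_most_continuum \<V> \<and> \<Union>\<V> = topspace X"
      using lindelof by blast
  qed
  from bchoice[OF this] obtain \<V> where "\<forall>F\<in>I.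
      \<V> F \<subseteq> insert (W F) \<G> \<and> at_most_continuum (\<V> F) \<and> \<Union>(\<V> F) = topspace X" ..
  note \<V> = bspec[OF this]
  show thesis
  proof
    show "(\<Union>F\<in>I. \<V> F \<inter> \<G>) \<subseteq> \<G>"
      by blast
    have "at_most_continuum ?\<F>"
      by (intro at_most_continuum_finite_subsets at_most_continuum_Times assms(4)
          at_most_continuum_countable) simp
    then have "at_most_continuum I"
      by (rule at_most_continuum_subset) (auto simp: I_def)
    then show "at_most_continuum (\<Union>F\<in>I. \<V> F \<inter> \<G>)"
    proof (rule at_most_continuum_UN)
      show "at_most_continuum (\<V> F \<inter> \<G>)" if "F \<in> I" for F
        using \<V>[OF that] by (intro at_most_continuum_subset[of "\<V> F" "\<V> F \<inter> \<G>"]) auto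
    qed
    show "topspace X - K \<subseteq> \<Union> (\<Union>F\<in>I. \<V> F \<inter> \<G>)"
    proof
      fix y assume y: "y \<in> topspace X - K"
      \<comment> \<open>Choosing for each point of \<open>K\<close> an open set that misses
        \<open>y\<close>, compactness yields one \<open>F\<close> in \<open>I\<close> with
        \<open>y\<close> outside \<open>W F\<close>.\<close>
      have "\<exists>n. y \<notin> C x n" if "x \<in> K" for x
      proof -
        have "y \<notin> \<Inter> (range (C x))"
          using C(2)[OF that] y that by auto
        then show ?thesis
          by simp
      qed
      then obtain n where n: "\<And>x. x \<in> K \<Longrightarrow> y \<notin> C x (n x)"
        by metis
      have "x \<in> C x (n x)" if "x \<in> K" for x
        using INT_D[of x "C x" UNIV] C(2)[OF that] by simp
      then have "K \<subseteq> \<Union> ((\<lambda>x. C x (n x)) ` K)"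
        by blast
      moreover have "\<forall>T \<in> (\<lambda>x. C x (n x)) ` K. openin X T"
        using C(1) by blast
      ultimately obtain E where E: "finite E" "E \<subseteq> (\<lambda>x. C x (n x)) ` K" "K \<subseteq> \<Union> E"
        using assms(3) unfolding compactin_def by meson
      obtain G where G: "finite G" "G \<subseteq> K" "E = (\<lambda>x. C x (n x)) ` G"
        using finite_subset_image[OF E(1,2)] by blast
      let ?F = "(\<lambda>x. (x, n x)) ` G"
      have W: "W ?F = \<Union> E"
        by (simp add: W_def G(3))
      then have I: "?F \<in> I"
        using G(1,2) E(3) by (auto simp: I_def)
      moreover have "y \<notin> W ?F"
        using n G(2,3) W by auto
      moreover have "y \<in> \<Union>(\<V> ?F)"
        using \<V>[OF I] y by simp
      moreover have "\<V> ?F \<subseteq> insert (W ?F) \<G>"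
        using \<V>[OF I] by simp
      ultimately show "y \<in> \<Union> (\<Union>F\<in>I. \<V> F \<inter> \<G>)"
        by blast
    qed
  qed
qed

text \<open>A cover of the intersection, together with its complement, is refined by a covering
  \<open>\<A>\<close> whose members have closures inside the given sets. The finite answer to
  \<open>\<A>\<close> then selects a finite subcover, because closure commutes with finite
  unions.\<close>

lemma compactin_Inter_closure_of_answers:
  assumes "regular_space X"
    and t: "\<And>\<A>. \<A> \<in> open_coverings X \<Longrightarrow> finite (t \<A>) \<and> t \<A> \<subseteq> \<A>"
  shows "compactin X (\<Inter>\<A>\<in>open_coverings X. X closure_of \<Union>(t \<A>))"
proof -
  define K where "K = (\<Inter>\<A>\<in>open_coverings X. X closure_of \<Union>(t \<A>))"
  \<comment> \<open>The intersection runs over a nonempty family, so it is a closed subset of the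
    space.\<close>
  have "{topspace X} \<in> open_coverings X"
    by (simp add: open_coverings_def)
  then have closed: "closedin X K"
    unfolding K_def by (intro closedin_Inter) auto
  have base: "\<exists>V D. openin X V \<and> closedin X D \<and> x \<in> V \<and> V \<subseteq> D \<and> D \<subseteq> U"
    if "openin X U" "x \<in> U" for U x
    using assms(1) that
    unfolding neighbourhood_base_of_closedin[symmetric] neighbourhood_base_of by blast
  have "compactin X K"
    unfolding compactin_def
  proof (intro conjI allI impI)
    show "K \<subseteq> topspace X"
      using closed closedin_subset by blast
    fix \<U> assume \<U>: "(\<forall>U\<in>\<U>. openin X U) \<and> K \<subseteq> \<Union>\<U>"
    define \<A> where "\<A> = {V. openin X V \<and> (\<exists>U\<in>insert (topspace X - K) \<U>. X closure_of V \<subseteq> U)}"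
    have "\<Union>\<A> = topspace X"
    proof
      show "\<Union>\<A> \<subseteq> topspace X"
        using openin_subset by (auto simp: \<A>_def)
      show "topspace X \<subseteq> \<Union>\<A>"
      proof
        fix x assume "x \<in> topspace X"
        then obtain U where U: "U \<in> insert (topspace X - K) \<U>" "x \<in> U"
          using \<U> by blast
        then have "openin X U"
          using \<U> closed by (auto simp: openin_diff)
        then obtain V D where "openin X V" "closedin X D" "x \<in> V" "V \<subseteq> D" "D \<subseteq> U"
          using base U(2) by meson
        then have "V \<in> \<A>"
          using U(1) closure_of_minimal[of V D X] unfolding \<A>_def by blast
        then show "x \<in> \<Union>\<A>"
          using \<open>x \<in> V\<close> by blast
      qed
    qed
    then have \<A>: "\<A> \<in> open_coverings X"
      by (auto simp: open_coverings_def \<A>_def)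
    have "\<forall>V\<in>t \<A>. \<exists>U\<in>insert (topspace X - K) \<U>. X closure_of V \<subseteq> U"
      using t[OF \<A>] by (auto simp: \<A>_def)
    then obtain u where u: "\<And>V. V \<in> t \<A> \<Longrightarrow>
        u V \<in> insert (topspace X - K) \<U> \<and> X closure_of V \<subseteq> u V"
      by metis
    have "K \<subseteq> X closure_of \<Union>(t \<A>)"
      using \<A> unfolding K_def by blast
    also have "\<dots> = (\<Union>V\<in>t \<A>. X closure_of V)"
      using t[OF \<A>] by (simp add: closure_of_Union)
    also have "\<dots> \<subseteq> \<Union> (u ` t \<A>)"
      using u by blast
    \<comment> \<open>The complement of \<open>K\<close> contributes nothing to covering
      \<open>K\<close>; dropping it leaves only members of \<open>\<U>\<close>.\<close>
    finally have "K \<subseteq> \<Union> (u ` t \<A> - {topspace X - K})"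
      by blast
    moreover have "u ` t \<A> - {topspace X - K} \<subseteq> \<U>"
      using u by blast
    moreover have "finite (u ` t \<A> - {topspace X - K})"
      using t[OF \<A>] by simp
    ultimately show "\<exists>\<F>. finite \<F> \<and> \<F> \<subseteq> \<U> \<and> K \<subseteq> \<Union>\<F>"
      by meson
  qed
  then show ?thesis
    by (simp add: K_def)
qed

text \<open>A point outside \<open>K\<close> lies outside the closure of some answer. The
  complements of these closures are open, so continuum many of them suffice, and \<open>M\<close>
  collects one covering for each.\<close>

lemma inning_at_most_continuum:
  assumes lindelof: "\<And>\<U>. \<U> \<in> open_coverings X \<Longrightarrow>
      \<exists>\<V>\<subseteq>\<U>. at_most_continuum \<V> \<and> \<Union>\<V> = topspace X"
    and "regular_space X" "Hausdorff_space X" "points_gdelta X"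
    and t: "\<And>\<A>. \<A> \<in> open_coverings X \<Longrightarrow> finite (t \<A>) \<and> t \<A> \<subseteq> \<A>"
  obtains K M where "at_most_continuum K" "M \<subseteq> open_coverings X" "at_most_continuum M"
    "\<And>x. x \<in> topspace X - K \<Longrightarrow> \<exists>\<A>\<in>M. x \<notin> \<Union>(t \<A>)"
proof -
  define K where "K = (\<Inter>\<A>\<in>open_coverings X. X closure_of \<Union>(t \<A>))"
  have K: "compactin X K"
    unfolding K_def using compactin_Inter_closure_of_answers[OF assms(2) t] .
  then have small: "at_most_continuum K"
    using compactin_points_gdelta_at_most_continuum assms(3,4) by blast
  let ?G = "\<lambda>\<A>. topspace X - X closure_of \<Union>(t \<A>)"
  have "openin X G" if "G \<in> ?G ` open_coverings X" for G
    using that by auto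
  moreover have "topspace X - K \<subseteq> \<Union> (?G ` open_coverings X)"
    by (auto simp: K_def)
  ultimately obtain \<H> where \<H>: "\<H> \<subseteq> ?G ` open_coverings X" "at_most_continuum \<H>"
      "topspace X - K \<subseteq> \<Union>\<H>"
    using subcover_outside_compact[OF lindelof assms(4) K small, of "?G ` open_coverings X"] by metis
  define m where "m = inv_into (open_coverings X) ?G"
  have m: "m G \<in> open_coverings X" "?G (m G) = G" if "G \<in> \<H>" for G
    using that \<H>(1) inv_into_into[of G ?G] f_inv_into_f[of G ?G] unfolding m_def by blast+
  show thesis
  proof
    show "m ` \<H> \<subseteq> open_coverings X"
      using m(1) by blast
    show "at_most_continuum (m ` \<H>)"
      using \<H>(2) by (rule at_most_continuum_image)
    show "\<exists>\<A>\<in>m ` \<H>. x \<notin> \<Union>(t \<A>)" if x: "x \<in> topspace X - K" for x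
    proof -
      obtain G where G: "G \<in> \<H>" "x \<in> G"
        using \<H>(3) x by blast
      have "\<Union>(t (m G)) \<subseteq> topspace X"
        using t[OF m(1)[OF G(1)]] m(1)[OF G(1)] by (auto simp: open_coverings_def)
      then have "\<Union>(t (m G)) \<subseteq> X closure_of \<Union>(t (m G))"
        by (rule closure_of_subset)
      then have "x \<notin> \<Union>(t (m G))"
        using m(2)[OF G(1)] G(2) by blast
      then show ?thesis
        using G(1) by blast
    qed
  qed (rule small)
qed

section \<open>The long game\<close>

lemma Well_order_omega1: "Well_order omega1"
  unfolding omega1_def using natLeq_Card_order by (rule cardSuc_Well_order)

lemma countable_underS_omega1:
  assumes "a \<in> Field omega1"
  shows "countable (underS omega1 a)"
proof -
  have "|underS omega1 a| <o cardSuc natLeq"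
    using card_of_underS[OF cardSuc_Card_order[OF natLeq_Card_order]] assms
    unfolding omega1_def by blast
  then have "|underS omega1 a| \<le>o natLeq"
    using cardSuc_ordLeq_ordLess[OF natLeq_Card_order card_of_Card_order] by blast
  then have "|underS omega1 a| \<le>o |UNIV :: nat set|"
    using ordLeq_ordIso_trans ordIso_symmetric[OF card_of_nat] by blast
  then show ?thesis
    unfolding countable_def using card_of_ordLeq[of "underS omega1 a" "UNIV :: nat set"] by blast
qed

text \<open>By Cantor the continuum exceeds \<open>natLeq\<close>, and \<open>cardSuc natLeq\<close>
  is the least cardinal that does.\<close>

lemma at_most_continuum_Field_omega1: "at_most_continuum (Field omega1)"
proof -
  have "|UNIV :: nat set| <o |UNIV :: nat set set|"
    using card_of_Pow[of "UNIV :: nat set"] by simp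
  then have "natLeq <o |UNIV :: nat set set|"
    using ordIso_ordLess_trans[OF ordIso_symmetric[OF card_of_nat]] by blast
  then have le: "omega1 \<le>o |UNIV :: nat set set|"
    unfolding omega1_def using cardSuc_least[OF natLeq_Card_order card_of_Card_order] by blast
  have "|Field omega1| =o omega1"
    unfolding omega1_def using card_of_Field_ordIso cardSuc_Card_order natLeq_Card_order by blast
  then show ?thesis
    using le by (rule ordIso_ordLeq_trans)
qed

text \<open>Countable initial segments bound the number of positions before an inning; the size of
  \<open>Field r\<close> bounds the number of innings and the size of subcoverings.\<close>

theorem menger_winning_at_most_continuum:
  fixes X :: "'a topology" and r :: "'i rel"
  assumes "Well_order r" "\<And>a. a \<in> Field r \<Longrightarrow> countable (underS r a)"
    and Field: "at_most_continuum (Field r)"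
    and "regular_space X" "Hausdorff_space X" "points_gdelta X"
    and win: "menger_winning_strategy_II r X s"
  shows "at_most_continuum (topspace X)"
proof -
  have wo: "wo_rel r"
    using assms(1) by (simp add: wo_rel_def)
  have legal: "finite (s \<xi> p) \<and> s \<xi> p \<subseteq> p \<xi>"
    if "\<xi> \<in> Field r" "p \<in> under r \<xi> \<rightarrow>\<^sub>E open_coverings X" for \<xi> p
    using win that unfolding menger_winning_strategy_II_def menger_strategy_II_def by blast
  have covers: "\<Union>(\<Union>\<xi> \<in> Field r. s \<xi> (restrict A (under r \<xi>))) = topspace X"
    if "A \<in> Field r \<rightarrow>\<^sub>E open_coverings X" for A
    using win that unfolding menger_winning_strategy_II_def by blast
  have under: "under r \<xi> = insert \<xi> (underS r \<xi>)" if "\<xi> \<in> Field r" for \<xi>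
    using Refl_under_underS[OF wo_rel.REFL[OF wo] that] by auto
  \<comment> \<open>Player I repeats \<open>\<U>\<close> in every inning; the finite answers
    together form the subcovering.\<close>
  have lindelof: "\<exists>\<V>\<subseteq>\<U>. at_most_continuum \<V> \<and> \<Union>\<V> = topspace X"
    if \<U>: "\<U> \<in> open_coverings X" for \<U>
  proof -
    let ?A = "restrict (\<lambda>_. \<U>) (Field r)"
    let ?\<V> = "\<Union>\<xi> \<in> Field r. s \<xi> (restrict ?A (under r \<xi>))"
    have s: "finite (s \<xi> (restrict ?A (under r \<xi>))) \<and> s \<xi> (restrict ?A (under r \<xi>)) \<subseteq> \<U>"
      if "\<xi> \<in> Field r" for \<xi>
    proof -
      have "restrict ?A (under r \<xi>) \<in> under r \<xi> \<rightarrow>\<^sub>E open_coverings X"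
        using \<U> under_Field[of r \<xi>] by auto
      then show ?thesis
        using legal[OF that] under[OF that] that by (metis insertI1 restrict_apply')
    qed
    have "at_most_continuum ?\<V>"
      using s by (intro at_most_continuum_UN[OF Field] at_most_continuum_countable
          countable_finite) simp
    moreover have "?\<V> \<subseteq> \<U>"
      using s by blast
    moreover have "\<Union>?\<V> = topspace X"
      using covers[of ?A] \<U> by simp
    ultimately show ?thesis
      by blast
  qed
  \<comment> \<open>Here \<open>q\<close> is the position before inning \<open>\<xi>\<close>, and
    \<open>q(\<xi> := \<A>)\<close> extends it by the current move of player I.\<close>
  define good where "good \<xi> q K M \<longleftrightarrow> at_most_continuum K \<and> M \<subseteq> open_coverings X \<and>
      at_most_continuum M \<and> (\<forall>x\<in>topspace X - K. \<exists>\<A>\<in>M. x \<notin> \<Union>(s \<xi> (q(\<xi> := \<A>))))" for \<xi> q K M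
  have "\<exists>K M. good \<xi> q K M"
    if "\<xi> \<in> Field r" "q \<in> underS r \<xi> \<rightarrow>\<^sub>E open_coverings X" for \<xi> q
  proof -
    have "finite (s \<xi> (q(\<xi> := \<A>))) \<and> s \<xi> (q(\<xi> := \<A>)) \<subseteq> \<A>" if "\<A> \<in> open_coverings X" for \<A>
    proof -
      have "q(\<xi> := \<A>) \<in> under r \<xi> \<rightarrow>\<^sub>E open_coverings X"
        using that \<open>q \<in> _\<close> under[OF \<open>\<xi> \<in> Field r\<close>] by (auto simp: PiE_iff extensional_def)
      then show ?thesis
        using legal[OF \<open>\<xi> \<in> Field r\<close>, of "q(\<xi> := \<A>)"] by simp
    qed
    from inning_at_most_continuum[OF lindelof assms(4,5,6) this] show ?thesis
      unfolding good_def by (smt (verit))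
  qed
  then obtain K M where "\<And>\<xi> q. \<xi> \<in> Field r \<Longrightarrow> q \<in> underS r \<xi> \<rightarrow>\<^sub>E open_coverings X \<Longrightarrow>
      good \<xi> q (K \<xi> q) (M \<xi> q)"
    by metis
  note KM = this[unfolded good_def]
  \<comment> \<open>The empty default outside legal positions gives bounds for all arguments, as the
    counting of branches requires.\<close>
  define M' where "M' \<xi> q =
    (if \<xi> \<in> Field r \<and> q \<in> underS r \<xi> \<rightarrow>\<^sub>E open_coverings X then M \<xi> q else {})" for \<xi> q
  have M': "at_most_continuum (M' \<xi> q)" "M' \<xi> q \<subseteq> open_coverings X" for \<xi> q
    using KM by (auto simp: M'_def at_most_continuum_countable)
  \<comment> \<open>These are the positions before inning \<open>\<xi>\<close> in the tree where
    player I only moves within \<open>M'\<close>.\<close>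
  define Q where "Q \<xi> = {p \<in> extensional (underS r \<xi>).
      \<forall>b\<in>underS r \<xi>. p b \<in> M' b (restrict p (underS r b))}" for \<xi>
  have Q: "at_most_continuum (Q \<xi>)" if "\<xi> \<in> Field r" for \<xi>
    unfolding Q_def using at_most_continuum_branches[OF assms(1) assms(2)[OF that] M'(1)] .
  have Q_legal: "q \<in> underS r \<xi> \<rightarrow>\<^sub>E open_coverings X" if "q \<in> Q \<xi>" for q \<xi>
    using that M'(2) by (auto simp: Q_def PiE_iff)
  have "topspace X \<subseteq> (\<Union>\<xi>\<in>Field r. \<Union>q\<in>Q \<xi>. K \<xi> q)"
  proof (rule ccontr)
    assume "\<not> ?thesis"
    then obtain x where x: "x \<in> topspace X"
      and nin: "\<And>\<xi> q. \<xi> \<in> Field r \<Longrightarrow> q \<in> Q \<xi> \<Longrightarrow> x \<notin> K \<xi> q"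
      by blast
    \<comment> \<open>Player I answers every position with a move that keeps \<open>x\<close>
      uncovered; \<open>P\<close> is the resulting run, obtained by recursion along
      \<open>r\<close>.\<close>
    define step where "step P \<xi> = (let q = restrict P (underS r \<xi>) in
      SOME \<A>. \<A> \<in> M' \<xi> q \<and> x \<notin> \<Union>(s \<xi> (q(\<xi> := \<A>))))" for P \<xi>
    have "wo_rel.adm_wo r step"
      unfolding wo_rel.adm_wo_def[OF wo]
    proof (intro allI impI)
      fix f g :: "'i \<Rightarrow> 'a set set" and \<xi> assume "\<forall>\<eta>\<in>underS r \<xi>. f \<eta> = g \<eta>"
      then have "restrict f (underS r \<xi>) = restrict g (underS r \<xi>)"
        by (auto intro: restrict_ext)
      then show "step f \<xi> = step g \<xi>"
        by (simp add: step_def)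
    qed
    then obtain P where P: "P = step P"
      using wo_rel.worec_fixpoint[OF wo] by metis
    have *: "P \<xi> \<in> M' \<xi> (restrict P (underS r \<xi>)) \<and>
        x \<notin> \<Union>(s \<xi> ((restrict P (underS r \<xi>))(\<xi> := P \<xi>)))" if "\<xi> \<in> Field r" for \<xi>
      using that
    proof (induction \<xi> rule: wf_induct_rule[OF wo_rel.WF[OF wo]])
      case (1 \<xi>)
      \<comment> \<open>By induction the earlier moves form a position in \<open>Q \<xi>\<close>, so
        \<open>x\<close> avoids its \<open>K\<close> and the choice in \<open>step\<close> has a
        witness.\<close>
      let ?q = "restrict P (underS r \<xi>)"
      have "P b \<in> M' b (restrict ?q (underS r b))" if b: "b \<in> underS r \<xi>" for b
      proof -
        have "underS r b \<subseteq> underS r \<xi>"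
          using underS_incr[OF wo_rel.TRANS[OF wo] wo_rel.ANTISYM[OF wo]] b by (auto simp: underS_def)
        then have "restrict ?q (underS r b) = restrict P (underS r b)"
          by (auto simp: fun_eq_iff)
        moreover have "(b, \<xi>) \<in> r - Id" "b \<in> Field r"
          using b by (auto simp: underS_def Field_def)
        ultimately show ?thesis
          using "1.IH"[of b] by metis
      qed
      then have q: "?q \<in> Q \<xi>"
        by (simp add: Q_def)
      then have "\<exists>\<A>\<in>M \<xi> ?q. x \<notin> \<Union>(s \<xi> (?q(\<xi> := \<A>)))"
        using KM[OF "1.prems" Q_legal[OF q]] nin[OF "1.prems" q] x by blast
      then have ex: "\<exists>\<A>. \<A> \<in> M' \<xi> ?q \<and> x \<notin> \<Union>(s \<xi> (?q(\<xi> := \<A>)))"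
        using "1.prems" Q_legal[OF q] by (auto simp: M'_def)
      have "P \<xi> = (SOME \<A>. \<A> \<in> M' \<xi> ?q \<and> x \<notin> \<Union>(s \<xi> (?q(\<xi> := \<A>))))"
        using fun_cong[OF P, of \<xi>] by (simp add: step_def Let_def)
      then show ?case
        using someI_ex[OF ex] by (simp only: simp_thms)
    qed
    let ?A = "restrict P (Field r)"
    have "?A \<in> Field r \<rightarrow>\<^sub>E open_coverings X"
      using subsetD[OF M'(2)] * by (intro restrict_PiE_iff[THEN iffD2] ballI) blast
    then obtain \<xi> where \<xi>: "\<xi> \<in> Field r" "x \<in> \<Union>(s \<xi> (restrict ?A (under r \<xi>)))"
      using covers x by blast
    \<comment> \<open>This identifies the position in the full play with the one in the recursion,
      where the answer misses \<open>x\<close>.\<close>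
    have "restrict ?A (under r \<xi>) = (restrict P (underS r \<xi>))(\<xi> := P \<xi>)"
      using under[OF \<xi>(1)] \<xi>(1) under_Field[of r \<xi>] by (auto simp: fun_eq_iff)
    then show False
      using * \<xi> by simp
  qed
  moreover have "at_most_continuum (\<Union>\<xi>\<in>Field r. \<Union>q\<in>Q \<xi>. K \<xi> q)"
    using KM Q_legal by (intro at_most_continuum_UN Field Q) blast+
  ultimately show ?thesis
    by (rule at_most_continuum_subset[rotated])
qed

theorem corollary2p12:
  fixes X :: "'a topology"
  assumes "continuum_hypothesis"
    and "tychonoff_space X"
    and "points_gdelta X"
    and "\<exists>s. menger_winning_strategy_II omega1 X s"
  shows "|topspace X| \<le>o ctwo ^c natLeq"
proof -
  have regular: "regular_space X"
    using assms(2) completely_regular_imp_regular_space by (auto simp: tychonoff_space_def)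
  moreover have "Hausdorff_space X"
    using regular assms(2) regular_t1_imp_Hausdorff_space by (auto simp: tychonoff_space_def)
  ultimately have "at_most_continuum (topspace X)"
    using menger_winning_at_most_continuum[OF Well_order_omega1 countable_underS_omega1
        at_most_continuum_Field_omega1] assms(3,4) by blast
  \<comment> \<open>The exponential unfolds to the functions from the naturals to
    \<open>bool\<close>, that is, to characteristic functions of sets of naturals.\<close>
  moreover have "|UNIV :: nat set set| =o ctwo ^c natLeq"
    using card_of_Pow_Func[of "UNIV :: nat set"]
    by (simp add: cexp_def ctwo_def Field_natLeq Field_card_of)
  ultimately show ?thesis
    using ordLeq_ordIso_trans by blast
qed

end
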